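(* Suppose that $\sum_{n=0}^\infty a_n^{-1}<\infty$, that $\beta_n\to\beta_\infty\in\mathbb R$ as $n\to\infty$ with $|\beta_\infty|>1$, that $\sum_n |k_n-1|<\infty$, and that $\sum_n|\beta_{n+1}-\beta_n|<\infty$. Then the Jacobi equation $$a_{n-1}F_{n-1}+b_nF_n+a_nF_{n+1}=zF_n,\qquad n\in\mathbb Z_+,$$ has a solution $(f_n(z))$ with asymptotics $$f_n(z)=\frac1{\sqrt{a_n}}\,(\operatorname{sgn}\beta_\infty)^ne^{-\varphi_n}\big(1+O(\varepsilon_n)\big),\qquad n\to\infty .$$ This asymptotics is uniform in $z$ from compact subsets of $\mathbb C$. For all $n\in\mathbb Z_+$, the functions $f_n(z)$ are entire functions of $z\in\mathbb C$ of minimal exponential type.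
   Context: $\mathbb Z_+=\{0,1,2,\dots\}$. The coefficients satisfy $a_n>0$, $b_n\in\mathbb R$ for $n\in\mathbb Z_+$, and by convention $a_{-1}=1/2$. Notation: $$\beta_n=-\frac{b_n}{2\sqrt{a_{n-1}a_n}},\qquad \alpha_n=\frac1{2\sqrt{a_{n-1}a_n}},\qquad k_n=\frac{a_n}{\sqrt{a_{n-1}a_{n+1}}}.$$ The phase is $\varphi_n=\sum_m\operatorname{arccosh}|\beta_m|$, the sum being over those $m\in\{0,\dots,n-1\}$ with $|\beta_m|\ge1$. The remainder is $$\varepsilon_n=\sum_{m=n+1}^\infty\big(|\beta_{m-1}-\beta_m|+|k_m-1|+\alpha_m|z|\big).$$ An entire function $h$ is of minimal exponential type if for every $\varepsilon>0$ there is $C(\varepsilon)$ with $|h(z)|\le C(\varepsilon)e^{\varepsilon|z|}$ for all $z\in\mathbb C$. *)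

theory Defs
  imports "HOL-Analysis.Analysis"
begin

text \<open>
  The coefficients are sequences \<open>a b :: nat \<Rightarrow> real\<close>; \<open>coeff_pred a n\<close> is $a_{n-1}$,
  with the convention $a_{-1} = 1/2$.
\<close>

definition coeff_pred :: "(nat \<Rightarrow> real) \<Rightarrow> nat \<Rightarrow> real" where
  "coeff_pred a n = (case n of 0 \<Rightarrow> 1/2 | Suc m \<Rightarrow> a m)"

definition jacobi_alpha :: "(nat \<Rightarrow> real) \<Rightarrow> nat \<Rightarrow> real" where
  "jacobi_alpha a n = 1 / (2 * sqrt (coeff_pred a n * a n))"

definition jacobi_beta :: "(nat \<Rightarrow> real) \<Rightarrow> (nat \<Rightarrow> real) \<Rightarrow> nat \<Rightarrow> real" where
  "jacobi_beta a b n = - b n / (2 * sqrt (coeff_pred a n * a n))"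

definition jacobi_k :: "(nat \<Rightarrow> real) \<Rightarrow> nat \<Rightarrow> real" where
  "jacobi_k a n = a n / sqrt (coeff_pred a n * a (n + 1))"

definition jacobi_phase :: "(nat \<Rightarrow> real) \<Rightarrow> (nat \<Rightarrow> real) \<Rightarrow> nat \<Rightarrow> real" where
  "jacobi_phase a b n = (\<Sum>m | m < n \<and> \<bar>jacobi_beta a b m\<bar> \<ge> 1. arcosh \<bar>jacobi_beta a b m\<bar>)"

text \<open>The summand of the remainder is only used for \<open>m \<ge> 1\<close>, so \<open>m - 1\<close> does not truncate.\<close>

definition remainder_term ::
    "(nat \<Rightarrow> real) \<Rightarrow> (nat \<Rightarrow> real) \<Rightarrow> complex \<Rightarrow> nat \<Rightarrow> real" where
  "remainder_term a b z m =
     \<bar>jacobi_beta a b (m - 1) - jacobi_beta a b m\<bar> + \<bar>jacobi_k a m - 1\<bar> + jacobi_alpha a m * norm z"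

definition jacobi_remainder ::
    "(nat \<Rightarrow> real) \<Rightarrow> (nat \<Rightarrow> real) \<Rightarrow> complex \<Rightarrow> nat \<Rightarrow> real" where
  "jacobi_remainder a b z n = (\<Sum>j. remainder_term a b z (n + 1 + j))"

text \<open>
  The equation at \<open>n = 0\<close> involves $F_{-1}$, so solutions are indexed by \<^typ>\<open>int\<close>;
  their values at indices below $-1$ are irrelevant.
\<close>

definition jacobi_solution ::
    "(nat \<Rightarrow> real) \<Rightarrow> (nat \<Rightarrow> real) \<Rightarrow> complex \<Rightarrow> (int \<Rightarrow> complex) \<Rightarrow> bool" where
  "jacobi_solution a b z F \<longleftrightarrow>
     (\<forall>n::nat. of_real (coeff_pred a n) * F (int n - 1) + of_real (b n) * F (int n)
               + of_real (a n) * F (int n + 1) = z * F (int n))"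

definition minimal_exponential_type :: "(complex \<Rightarrow> complex) \<Rightarrow> bool" where
  "minimal_exponential_type h \<longleftrightarrow>
     (\<forall>\<epsilon>>0. \<exists>C::real. \<forall>z. norm (h z) \<le> C * exp (\<epsilon> * norm z))"

end

theory Submission
  imports Defs "HOL-Complex_Analysis.Complex_Analysis"
begin

text \<open>
  Let \<open>\<zeta>\<^sub>n\<close> be the root of \<open>\<zeta> + 1/\<zeta> = 2\<beta>\<^sub>n\<close> with \<open>\<bar>\<zeta>\<bar> < 1\<close>, so that \<open>\<zeta>\<^sub>n = s exp (- arcosh \<bar>\<beta>\<^sub>n\<bar>)\<close>
  with \<open>s = sgn \<beta>inf\<close> for large \<open>n\<close>. Put \<open>f\<^sub>n = u\<^sub>n s\<^sup>n exp (- \<phi>\<^sub>n) / sqrt a\<^sub>n\<close>. In terms of \<open>u\<close> and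
  \<open>y\<^sub>n = u\<^sub>n - u\<^sub>n\<^sub>+\<^sub>1\<close> the Jacobi equation reads \<open>y\<^sub>n = A\<^sub>n u\<^sub>n\<^sub>+\<^sub>1 + B\<^sub>n y\<^sub>n\<^sub>+\<^sub>1\<close> with
  \<open>\<bar>A\<^sub>n\<bar> \<le> E\<^sub>n\<close> and \<open>\<bar>B\<^sub>n\<bar> \<le> \<kappa> + E\<^sub>n\<close>, where \<open>\<kappa> < 1\<close> and \<open>E\<^sub>n\<close> is a multiple of the \<open>(n+1)\<close>-st summand of
  the remainder. One backward step therefore increases \<open>\<bar>u\<bar> + T \<bar>y\<bar>\<close>, with \<open>T = 1 / (1 - \<kappa>)\<close>,
  at most by a factor \<open>exp ((1 + T) E\<^sub>n)\<close>. Comparing the solutions that start from \<open>(u, y) = (1, 0)\<close> at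
  consecutive indices shows that they converge, locally uniformly in \<open>z\<close>, to a solution with
  \<open>\<bar>u\<^sub>n - 1\<bar> \<le> C \<epsilon>\<^sub>n exp (C \<epsilon>\<^sub>n)\<close>. Since the coefficient of \<open>\<bar>z\<bar>\<close> in \<open>\<epsilon>\<^sub>n\<close> tends to zero, \<open>u\<^sub>n\<close> is
  bounded by \<open>K exp (\<delta> \<bar>z\<bar>)\<close> for large \<open>n\<close>; backward recursion, whose coefficients are polynomials in
  \<open>z\<close>, carries this over to every index with an arbitrarily small loss in \<open>\<delta>\<close>.
\<close>

section \<open>Backward iteration and its limit\<close>

text \<open>The pair \<open>(u\<^sub>n, y\<^sub>n)\<close> of the backward solution that starts from \<open>(1, 0)\<close> at index \<open>n + j\<close>.\<close>

primrec bwd_iter :: "(nat \<Rightarrow> complex) \<Rightarrow> (nat \<Rightarrow> complex) \<Rightarrow> nat \<Rightarrow> nat \<Rightarrow> complex \<times> complex" where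
  "bwd_iter A B 0 n = (1, 0)"
| "bwd_iter A B (Suc j) n =
     (let (u, y) = bwd_iter A B j (Suc n); d = A n * u + B n * y in (u + d, d))"

lemma fst_bwd_iter_Suc:
  "fst (bwd_iter A B (Suc j) n) =
     fst (bwd_iter A B j (Suc n)) + snd (bwd_iter A B (Suc j) n)"
  by (simp add: Let_def split: prod.split)

lemma snd_bwd_iter_Suc:
  "snd (bwd_iter A B (Suc j) n) =
     A n * fst (bwd_iter A B j (Suc n)) + B n * snd (bwd_iter A B j (Suc n))"
  by (simp add: Let_def split: prod.split)

declare bwd_iter.simps(2) [simp del]

text \<open>With d = Au + By, the new weighted norm is at most |u| + (1 + T)|d|. The condition
  \<open>(1 + T) * \<kappa> \<le> T\<close> lets the old weight T|y| absorb the share of |y| that is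
  not small, so only terms with a factor \<open>E\<close> are left for the exponential.\<close>

lemma weighted_step_bound:
  fixes u y A B :: complex and \<kappa> T E :: real
  assumes A: "norm A \<le> E" and B: "norm B \<le> \<kappa> + E" and T: "T \<ge> 1" "(1 + T) * \<kappa> \<le> T"
  shows "norm (u + (A * u + B * y)) + T * norm (A * u + B * y)
           \<le> exp ((1 + T) * E) * (norm u + T * norm y)"
proof -
  have E: "E \<ge> 0" using A norm_ge_zero order_trans by blast
  have d: "norm (A * u + B * y) \<le> E * norm u + (\<kappa> + E) * norm y"
    by (rule order_trans[OF norm_triangle_ineq])
       (intro add_mono, auto simp: norm_mult intro!: mult_right_mono A B)
  have "norm (u + (A * u + B * y)) + T * norm (A * u + B * y)
          \<le> norm u + (1 + T) * norm (A * u + B * y)"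
    using norm_triangle_ineq[of u "A * u + B * y"] by (simp add: algebra_simps)
  also have "\<dots> \<le> norm u + (1 + T) * (E * norm u + (\<kappa> + E) * norm y)"
    using d T by (intro add_left_mono mult_left_mono) auto
  also have "\<dots> = norm u + (1 + T) * E * norm u + ((1 + T) * \<kappa>) * norm y + (1 + T) * E * norm y"
    by (simp add: algebra_simps)
  also have "\<dots> \<le> norm u + (1 + T) * E * norm u + T * norm y + (1 + T) * E * (T * norm y)"
  proof -
    have "norm y \<le> T * norm y"
      using T mult_right_mono[of 1 T "norm y"] by simp
    then show ?thesis
      using T E by (intro add_mono mult_left_mono mult_right_mono) auto
  qed
  also have "\<dots> = (1 + (1 + T) * E) * (norm u + T * norm y)"
    by (simp add: algebra_simps)
  also have "\<dots> \<le> exp ((1 + T) * E) * (norm u + T * norm y)"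
    using T by (intro mult_right_mono) auto
  finally show ?thesis .
qed

text \<open>Two solutions started at consecutive indices differ by a solution of the same linear
  recursion. At index n + j this difference is the pair (A, A), of weighted norm (1 + T)|A|, and
  each of the j steps down to n costs one exponential factor.\<close>

lemma bwd_iter_diff_bound:
  fixes A B :: "nat \<Rightarrow> complex" and E :: "nat \<Rightarrow> real"
  assumes A: "\<And>n. norm (A n) \<le> E n" and B: "\<And>n. norm (B n) \<le> \<kappa> + E n"
    and T: "T \<ge> 1" "(1 + T) * \<kappa> \<le> T"
  shows "norm (fst (bwd_iter A B (Suc j) n) - fst (bwd_iter A B j n))
           + T * norm (snd (bwd_iter A B (Suc j) n) - snd (bwd_iter A B j n))
         \<le> (1 + T) * E (n + j) * exp ((1 + T) * (\<Sum>m<j. E (n + m)))"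
proof (induction j arbitrary: n)
  case 0
  have "(1 + T) * norm (A n) \<le> (1 + T) * E n"
    using T A by (intro mult_left_mono) auto
  then show ?case
    unfolding fst_bwd_iter_Suc snd_bwd_iter_Suc by (simp add: algebra_simps)
next
  case (Suc j)
  define u where "u = fst (bwd_iter A B (Suc j) (Suc n)) - fst (bwd_iter A B j (Suc n))"
  define y where "y = snd (bwd_iter A B (Suc j) (Suc n)) - snd (bwd_iter A B j (Suc n))"
  have lin: "c * f1 + d * s1 - (c * f0 + d * s0) = c * (f1 - f0) + d * (s1 - s0)"
    for c d f0 f1 s0 s1 :: complex
    by (simp add: algebra_simps)
  have y': "snd (bwd_iter A B (Suc (Suc j)) n) - snd (bwd_iter A B (Suc j) n) = A n * u + B n * y"
    unfolding u_def y_def snd_bwd_iter_Suc[of A B "Suc j" n] snd_bwd_iter_Suc[of A B j n]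
    by (rule lin)
  have "fst (bwd_iter A B (Suc (Suc j)) n) - fst (bwd_iter A B (Suc j) n)
          = u + (snd (bwd_iter A B (Suc (Suc j)) n) - snd (bwd_iter A B (Suc j) n))"
    unfolding fst_bwd_iter_Suc[of A B "Suc j" n] fst_bwd_iter_Suc[of A B j n] u_def
    by (simp add: algebra_simps)
  then have u': "fst (bwd_iter A B (Suc (Suc j)) n) - fst (bwd_iter A B (Suc j) n)
              = u + (A n * u + B n * y)"
    unfolding y' .
  have "norm (u + (A n * u + B n * y)) + T * norm (A n * u + B n * y)
          \<le> exp ((1 + T) * E n) * (norm u + T * norm y)"
    by (rule weighted_step_bound[OF A B T])
  also have "\<dots> \<le> exp ((1 + T) * E n) *
      ((1 + T) * E (Suc n + j) * exp ((1 + T) * (\<Sum>m<j. E (Suc n + m))))"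
    using Suc.IH[of "Suc n"] unfolding u_def y_def by (intro mult_left_mono) auto
  also have "\<dots> = (1 + T) * E (n + Suc j) * exp ((1 + T) * (\<Sum>m<Suc j. E (n + m)))"
    by (simp only: sum.lessThan_Suc_shift distrib_left exp_add) simp
  finally show ?case unfolding u' y' .
qed

lemma holomorphic_bwd_iter:
  assumes "\<And>n. A n holomorphic_on S" "\<And>n. B n holomorphic_on S"
  shows "(\<lambda>z. fst (bwd_iter (\<lambda>n. A n z) (\<lambda>n. B n z) j n)) holomorphic_on S \<and>
         (\<lambda>z. snd (bwd_iter (\<lambda>n. A n z) (\<lambda>n. B n z) j n)) holomorphic_on S"
proof (induction j arbitrary: n)
  case (Suc j)
  have s: "(\<lambda>z. snd (bwd_iter (\<lambda>n. A n z) (\<lambda>n. B n z) (Suc j) n)) holomorphic_on S"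
    unfolding snd_bwd_iter_Suc using Suc assms by (intro holomorphic_intros) auto
  moreover have "(\<lambda>z. fst (bwd_iter (\<lambda>n. A n z) (\<lambda>n. B n z) (Suc j) n)) holomorphic_on S"
    unfolding fst_bwd_iter_Suc using Suc s by (intro holomorphic_intros) auto
  ultimately show ?case by blast
qed auto

text \<open>The starting index n + j is sent to infinity. The increments in j are dominated by a
  summable sequence, uniformly on balls, so the M-test gives an entire limit that inherits the
  recursion. The first iterate being 1, summing the increments bounds u - 1.\<close>

lemma backward_recursion_solution:
  fixes A B :: "nat \<Rightarrow> complex \<Rightarrow> complex" and p q :: "nat \<Rightarrow> real"
  assumes hol: "\<And>n. A n holomorphic_on UNIV" "\<And>n. B n holomorphic_on UNIV"
    and \<kappa>: "0 \<le> \<kappa>" "\<kappa> < 1"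
    and pq: "\<And>n. 0 \<le> p n" "\<And>n. 0 \<le> q n" "summable p" "summable q"
    and A: "\<And>n z. norm (A n z) \<le> p n + q n * norm z"
    and B: "\<And>n z. norm (B n z) \<le> \<kappa> + (p n + q n * norm z)"
  obtains C u where
    "C \<ge> 0"
    "\<And>n. u n holomorphic_on UNIV"
    "\<And>n z. u n z - u (Suc n) z =
       A n z * u (Suc n) z + B n z * (u (Suc n) z - u (Suc (Suc n)) z)"
    "\<And>n z. norm (u n z - 1) \<le> C * (\<Sum>m. p (n + m) + q (n + m) * norm z)
              * exp (C * (\<Sum>m. p (n + m) + q (n + m) * norm z))"
proof -
  \<comment> \<open>This value solves T = 1 + T \<kappa>, whence (1 + T) \<kappa> = T - 1 + \<kappa>
    \<le> T.\<close>
  define T where "T = 1 / (1 - \<kappa>)"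
  have "T = 1 + T * \<kappa>" using \<kappa> by (simp add: T_def field_simps)
  moreover have "T * \<kappa> \<ge> 0" using \<kappa> by (simp add: T_def)
  ultimately have T: "T \<ge> 1" "(1 + T) * \<kappa> \<le> T"
    using \<kappa>(2) unfolding distrib_right by linarith+
  define C where "C = 1 + T"
  have C: "C \<ge> 0" using T by (simp add: C_def)
  define E where "E = (\<lambda>r n. p n + q n * r)"
  have E0: "E r n \<ge> 0" if "r \<ge> 0" for r n using pq that by (simp add: E_def)
  have Esum: "summable (\<lambda>m. E r (n + m))" for r n
    unfolding E_def using pq(3,4)
    by (intro summable_add summable_mult2) (simp_all add: summable_iff_shift add.commute[of n])
  define U where "U = (\<lambda>j n z. fst (bwd_iter (\<lambda>n. A n z) (\<lambda>n. B n z) j n))"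
  \<comment> \<open>The radius r is kept apart from |z|: a fixed r serves the M-test on a ball,
    while r = |z| gives the final pointwise estimate.\<close>
  have diff: "norm (U (Suc j) n z - U j n z) \<le> C * E r (n + j) * exp (C * (\<Sum>m. E r (n + m)))"
    if r: "norm z \<le> r" for j n z r
  proof -
    have r0: "r \<ge> 0" using r norm_ge_zero order_trans by blast
    have le: "p n + q n * norm z \<le> E r n" for n
      unfolding E_def using r pq by (intro add_left_mono mult_left_mono) auto
    have "norm (U (Suc j) n z - U j n z) \<le> C * E r (n + j) * exp (C * (\<Sum>m<j. E r (n + m)))"
    proof -
      have "norm (U (Suc j) n z - U j n z) +
            T * norm (snd (bwd_iter (\<lambda>n. A n z) (\<lambda>n. B n z) (Suc j) n)
                      - snd (bwd_iter (\<lambda>n. A n z) (\<lambda>n. B n z) j n))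
         \<le> C * E r (n + j) * exp (C * (\<Sum>m<j. E r (n + m)))"
        unfolding U_def C_def
      proof (rule bwd_iter_diff_bound[OF _ _ T])
        show "norm (A n z) \<le> E r n" for n using A[of n z] le[of n] by linarith
        show "norm (B n z) \<le> \<kappa> + E r n" for n using B[of n z] le[of n] by linarith
      qed
      moreover have "T * norm (snd (bwd_iter (\<lambda>n. A n z) (\<lambda>n. B n z) (Suc j) n)
                      - snd (bwd_iter (\<lambda>n. A n z) (\<lambda>n. B n z) j n)) \<ge> 0"
        using T by simp
      ultimately show ?thesis by linarith
    qed
    also have "\<dots> \<le> C * E r (n + j) * exp (C * (\<Sum>m. E r (n + m)))"
      using C E0[OF r0] Esum
      by (intro mult_left_mono) (auto intro!: mult_left_mono sum_le_suminf)
    finally show ?thesis .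
  qed
  have bnd_sums: "(\<lambda>j. C * E r (n + j) * exp (C * (\<Sum>m. E r (n + m))))
      sums (C * (\<Sum>m. E r (n + m)) * exp (C * (\<Sum>m. E r (n + m))))" for r n
    by (intro sums_mult sums_mult2 summable_sums Esum)
  define u where "u = (\<lambda>n z. 1 + (\<Sum>j. U (Suc j) n z - U j n z))"
  have part: "U j n z = 1 + (\<Sum>i<j. U (Suc i) n z - U i n z)" for j n z
    using sum_lessThan_telescope[of "\<lambda>i. U i n z" j] by (simp add: U_def)
  have unif: "uniform_limit (cball 0 r) (\<lambda>j z. U j n z) (u n) sequentially" for r n
  proof -
    have "uniform_limit (cball 0 r) (\<lambda>j z. \<Sum>i<j. U (Suc i) n z - U i n z)
            (\<lambda>z. \<Sum>j. U (Suc j) n z - U j n z) sequentially"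
      by (rule Weierstrass_m_test[OF _ sums_summable[OF bnd_sums[of r n]]]) (auto intro!: diff)
    from uniform_limit_add[OF uniform_limit_const[of "\<lambda>_. 1"] this]
    show ?thesis unfolding u_def by (simp only: part[symmetric])
  qed
  have lim: "(\<lambda>j. U j n z) \<longlonglongrightarrow> u n z" for n z
    by (rule tendsto_uniform_limitI[OF unif[where r = "norm z"]]) simp
  show ?thesis
  proof (rule that[OF C])
    show "u n holomorphic_on UNIV" for n
    proof (rule holomorphic_uniform_sequence[OF open_UNIV])
      show "U j n holomorphic_on UNIV" for j
        using holomorphic_bwd_iter[where A = A and B = B] hol unfolding U_def by blast
      fix x :: complex
      show "\<exists>d>0. cball x d \<subseteq> UNIV \<and> uniform_limit (cball x d) (\<lambda>j. U j n) (u n) sequentially"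
      proof (intro exI[of _ 1] conjI)
        have "cball x 1 \<subseteq> cball 0 (norm x + 1)"
          by (rule cball_subset_cball_iff[THEN iffD2]) (simp add: dist_norm)
        then show "uniform_limit (cball x 1) (\<lambda>j. U j n) (u n) sequentially"
          by (rule uniform_limit_on_subset[OF unif])
      qed auto
    qed
    show "u n z - u (Suc n) z = A n z * u (Suc n) z + B n z * (u (Suc n) z - u (Suc (Suc n)) z)" for n z
    proof (rule LIMSEQ_unique)
      \<comment> \<open>Both iterates start at index n + j + 2, so they are neighbouring values of
        one backward solution and their difference is its y-component.\<close>
      show "(\<lambda>j. U (Suc (Suc j)) n z - U (Suc j) (Suc n) z) \<longlonglongrightarrow> u n z - u (Suc n) z"
        by (intro tendsto_diff LIMSEQ_Suc lim)
      have y: "U (Suc j) n z - U j (Suc n) z = snd (bwd_iter (\<lambda>n. A n z) (\<lambda>n. B n z) (Suc j) n)" for j n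
        unfolding U_def fst_bwd_iter_Suc by simp
      have "U (Suc (Suc j)) n z - U (Suc j) (Suc n) z
          = A n z * U (Suc j) (Suc n) z + B n z * (U (Suc j) (Suc n) z - U j (Suc (Suc n)) z)" for j
        unfolding y by (subst snd_bwd_iter_Suc) (simp only: U_def)
      moreover have "(\<lambda>j. A n z * U (Suc j) (Suc n) z
            + B n z * (U (Suc j) (Suc n) z - U j (Suc (Suc n)) z))
          \<longlonglongrightarrow> A n z * u (Suc n) z + B n z * (u (Suc n) z - u (Suc (Suc n)) z)"
        by (intro tendsto_intros LIMSEQ_Suc lim)
      ultimately show "(\<lambda>j. U (Suc (Suc j)) n z - U (Suc j) (Suc n) z)
          \<longlonglongrightarrow> A n z * u (Suc n) z + B n z * (u (Suc n) z - u (Suc (Suc n)) z)"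
        by simp
    qed
    show "norm (u n z - 1) \<le> C * (\<Sum>m. p (n + m) + q (n + m) * norm z)
              * exp (C * (\<Sum>m. p (n + m) + q (n + m) * norm z))" for n z
    proof -
      have "norm (\<Sum>j. U (Suc j) n z - U j n z)
          \<le> (\<Sum>j. C * E (norm z) (n + j) * exp (C * (\<Sum>m. E (norm z) (n + m))))"
        by (rule norm_suminf_le) (auto intro!: diff sums_summable[OF bnd_sums])
      also have "\<dots> = C * (\<Sum>m. E (norm z) (n + m)) * exp (C * (\<Sum>m. E (norm z) (n + m)))"
        by (rule sums_unique[OF bnd_sums, symmetric])
      finally show ?thesis by (simp add: u_def E_def)
    qed
  qed
qed

section \<open>Growth in z and descent to small indices\<close>

text \<open>The bounds are assumed for every exponent above \<open>\<delta>0\<close>, not at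
  \<open>\<delta>0\<close> itself, because the factor z costs an arbitrarily small increase. In this
  form the property is stable under repeated recursion.\<close>

lemma exp_bound_recursion:
  fixes F G :: "complex \<Rightarrow> complex" and \<delta>0 :: real
  assumes F: "\<And>\<delta>. \<delta> > \<delta>0 \<Longrightarrow> \<exists>C. \<forall>z. norm (F z) \<le> C * exp (\<delta> * norm z)"
    and G: "\<And>\<delta>. \<delta> > \<delta>0 \<Longrightarrow> \<exists>C. \<forall>z. norm (G z) \<le> C * exp (\<delta> * norm z)"
    and \<delta>: "\<delta> > \<delta>0"
  shows "\<exists>C. \<forall>z. norm (((z - b) * F z - a * G z) / c) \<le> C * exp (\<delta> * norm z)"
proof -
  \<comment> \<open>Half of the gap pays for the factor z, through |z| \<le> exp (\<eta> |z|) /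
    \<eta>.\<close>
  define \<eta> where "\<eta> = (\<delta> - \<delta>0) / 2"
  have \<eta>: "\<eta> > 0" "\<delta> - \<eta> > \<delta>0" using \<delta> by (auto simp: \<eta>_def field_simps)
  obtain C where C: "norm (F z) \<le> C * exp ((\<delta> - \<eta>) * norm z)" for z
    using F[OF \<eta>(2)] by blast
  obtain D where D: "norm (G z) \<le> D * exp (\<delta> * norm z)" for z
    using G[OF \<delta>] by blast
  have C0: "C \<ge> 0" using order_trans[OF norm_ge_zero C[of 0]] by simp
  define K where "K = ((1 / \<eta> + norm b) * C + norm a * D) / norm c"
  have "norm (((z - b) * F z - a * G z) / c) \<le> K * exp (\<delta> * norm z)" for z
  proof -
    have "norm z \<le> exp (\<eta> * norm z) / \<eta>"
    proof -
      have "\<eta> * norm z \<le> exp (\<eta> * norm z)"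
        using exp_ge_add_one_self[of "\<eta> * norm z"] by linarith
      then show ?thesis using \<eta> by (simp add: pos_le_divide_eq mult.commute)
    qed
    moreover have "norm b \<le> norm b * exp (\<eta> * norm z)"
      using \<eta> mult_left_mono[of 1 "exp (\<eta> * norm z)" "norm b"] by simp
    ultimately have "norm (z - b) \<le> (1 / \<eta> + norm b) * exp (\<eta> * norm z)"
      using norm_triangle_ineq4[of z b] by (simp add: algebra_simps)
    then have "norm ((z - b) * F z)
        \<le> ((1 / \<eta> + norm b) * exp (\<eta> * norm z)) * (C * exp ((\<delta> - \<eta>) * norm z))"
      unfolding norm_mult using C[of z] \<eta> by (intro mult_mono) auto
    also have "\<dots> = (1 / \<eta> + norm b) * C * exp (\<delta> * norm z)"
      using exp_add[of "\<eta> * norm z" "(\<delta> - \<eta>) * norm z"]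
      unfolding distrib_right[symmetric] by simp
    finally have 1: "norm ((z - b) * F z) \<le> (1 / \<eta> + norm b) * C * exp (\<delta> * norm z)" .
    have 2: "norm (a * G z) \<le> norm a * D * exp (\<delta> * norm z)"
      using mult_left_mono[OF D[of z], of "norm a"] by (simp add: norm_mult mult.assoc)
    have "norm ((z - b) * F z - a * G z) \<le> ((1 / \<eta> + norm b) * C + norm a * D) * exp (\<delta> * norm z)"
      using norm_triangle_ineq4[of "(z - b) * F z" "a * G z"] 1 2 by (simp add: distrib_right)
    then show ?thesis
      unfolding K_def norm_divide by (simp add: divide_right_mono)
  qed
  then show ?thesis by blast
qed

text \<open>Each induction step lowers the threshold by one: the value at N is overwritten by the
  one that the recursion prescribes, which leaves the later equations untouched.\<close>

lemma backward_extension: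
  fixes g :: "nat \<Rightarrow> 'a" and step :: "nat \<Rightarrow> 'a \<Rightarrow> 'a \<Rightarrow> 'a"
  assumes "\<And>n. n \<ge> N \<Longrightarrow> g n = step n (g (Suc n)) (g (Suc (Suc n)))"
  shows "\<exists>h. (\<forall>n\<ge>N. h n = g n) \<and> (\<forall>n. h n = step n (h (Suc n)) (h (Suc (Suc n))))"
  using assms
proof (induction N arbitrary: g)
  case 0
  then show ?case by blast
next
  case (Suc N)
  define g' where "g' = g(N := step N (g (Suc N)) (g (Suc (Suc N))))"
  have "g' n = step n (g' (Suc n)) (g' (Suc (Suc n)))" if "n \<ge> N" for n
    using Suc.prems[of n] that by (cases "n = N") (auto simp: g'_def)
  from Suc.IH[OF this] obtain h where
    h: "\<forall>n\<ge>N. h n = g' n" "\<forall>n. h n = step n (h (Suc n)) (h (Suc (Suc n)))"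
    by blast
  have "h n = g n" if "n \<ge> Suc N" for n
    using h(1) that by (simp add: g'_def)
  then show ?case using h(2) by blast
qed

lemma backward_induct:
  fixes P :: "nat \<Rightarrow> bool"
  assumes "\<And>n. n \<ge> N \<Longrightarrow> P n" and "\<And>n. P (Suc n) \<Longrightarrow> P (Suc (Suc n)) \<Longrightarrow> P n"
  shows "P n"
proof (induction "N - n" arbitrary: n rule: less_induct)
  case less
  show ?case
  proof (cases "n \<ge> N")
    case False
    then have "N - Suc n < N - n" "N - Suc (Suc n) < N - n" by auto
    then show ?thesis by (intro assms(2)[OF less less])
  qed (use assms(1) in auto)
qed

section \<open>Characteristic roots\<close>

text \<open>For large n the sign s of the limit is that of \<open>\<beta> n\<close>. As 1/s = s, the
  root plus its inverse is 2 s cosh (arcosh |\<beta>|) = 2 s |\<beta>| = 2 \<beta>.\<close>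

lemma eventually_joukowski_ratio:
  fixes \<beta> :: "nat \<Rightarrow> real"
  assumes "\<beta> \<longlonglongrightarrow> l" "\<bar>l\<bar> > 1"
  obtains \<rho> N where "0 \<le> \<rho>" "\<rho> < 1" "\<And>n. n \<ge> N \<Longrightarrow> \<bar>\<beta> n\<bar> \<ge> 1"
    "\<And>n. n \<ge> N \<Longrightarrow> \<bar>sgn l * exp (- arcosh \<bar>\<beta> n\<bar>)\<bar> \<le> \<rho>"
    "\<And>n. n \<ge> N \<Longrightarrow>
       sgn l * exp (- arcosh \<bar>\<beta> n\<bar>) + 1 / (sgn l * exp (- arcosh \<bar>\<beta> n\<bar>)) = 2 * \<beta> n"
proof -
  \<comment> \<open>Eventually |\<beta>| exceeds this midpoint of 1 and |l|, which confines the
    roots to the radius exp (- arcosh c) < 1.\<close>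
  define c where "c = (1 + \<bar>l\<bar>) / 2"
  have c: "1 < c" "c < \<bar>l\<bar>" using assms(2) by (auto simp: c_def)
  have "(\<lambda>n. sgn l * \<beta> n) \<longlonglongrightarrow> sgn l * l" by (intro tendsto_intros assms)
  then have "(\<lambda>n. sgn l * \<beta> n) \<longlonglongrightarrow> \<bar>l\<bar>" by (simp add: abs_sgn mult.commute)
  from order_tendstoD(1)[OF this c(2)] obtain N where N: "\<And>n. n \<ge> N \<Longrightarrow> sgn l * \<beta> n > c"
    by (auto simp: eventually_sequentially)
  have s: "\<bar>sgn l\<bar> = 1" "sgn l * sgn l = 1" using c by (auto simp: sgn_if)
  have abs: "\<bar>\<beta> n\<bar> = sgn l * \<beta> n" if "n \<ge> N" for n
    using N[OF that] c s by (auto simp: sgn_if split: if_splits)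
  show ?thesis
  proof (rule that[of "exp (- arcosh c)" N])
    have "arcosh c > 0" using arcosh_real_strict_mono[of 1 c] c by simp
    then show "exp (- arcosh c) < 1" by simp
    fix n assume n: "n \<ge> N"
    have le: "c < \<bar>\<beta> n\<bar>" using N[OF n] abs[OF n] by simp
    then show ge1: "\<bar>\<beta> n\<bar> \<ge> 1" using c by simp
    show "\<bar>sgn l * exp (- arcosh \<bar>\<beta> n\<bar>)\<bar> \<le> exp (- arcosh c)"
    proof -
      have "arcosh c < arcosh \<bar>\<beta> n\<bar>" by (rule arcosh_real_strict_mono) (use c le in auto)
      then show ?thesis using s by (simp add: abs_mult)
    qed
    have "sgn l * exp (- arcosh \<bar>\<beta> n\<bar>) + 1 / (sgn l * exp (- arcosh \<bar>\<beta> n\<bar>))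
        = sgn l * (2 * cosh (arcosh \<bar>\<beta> n\<bar>))"
      using s c by (auto simp: cosh_def exp_minus sgn_if field_simps split: if_splits)
    also have "\<dots> = 2 * \<beta> n"
      using ge1 abs[OF n] s by (simp add: mult.assoc[symmetric])
    finally show "sgn l * exp (- arcosh \<bar>\<beta> n\<bar>) + 1 / (sgn l * exp (- arcosh \<bar>\<beta> n\<bar>)) = 2 * \<beta> n" .
  qed auto
qed

text \<open>The identity (x/y - 1)(1 - xy) = x((y + 1/y) - (x + 1/x)) holds, and 1 - xy is at least
  1 - \<rho>^2. It makes the variation of the roots summable along with that of \<beta>.\<close>

lemma joukowski_ratio_diff:
  fixes x y :: real
  assumes "x \<noteq> 0" "y \<noteq> 0" "\<bar>x\<bar> \<le> \<rho>" "\<bar>y\<bar> \<le> \<rho>" "\<rho> < 1"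
  shows "\<bar>x / y - 1\<bar> \<le> \<bar>(y + 1 / y) - (x + 1 / x)\<bar> / (1 - \<rho>\<^sup>2)"
proof -
  have xy: "\<bar>x * y\<bar> \<le> \<rho>\<^sup>2"
    unfolding abs_mult power2_eq_square using assms by (intro mult_mono) auto
  have \<rho>: "\<rho>\<^sup>2 < 1" using assms by (simp add: abs_square_less_1)
  have "(x / y - 1) * (1 - x * y) = x * ((y + 1 / y) - (x + 1 / x))"
    using assms by (simp add: field_simps)
  then have "\<bar>x / y - 1\<bar> * \<bar>1 - x * y\<bar> = \<bar>x\<bar> * \<bar>(y + 1 / y) - (x + 1 / x)\<bar>"
    by (metis abs_mult)
  also have "\<dots> \<le> \<bar>(y + 1 / y) - (x + 1 / x)\<bar>"
    using assms by (intro mult_left_le_one_le) auto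
  finally have "\<bar>x / y - 1\<bar> * \<bar>1 - x * y\<bar> \<le> \<bar>(y + 1 / y) - (x + 1 / x)\<bar>" .
  moreover have "\<bar>x / y - 1\<bar> * (1 - \<rho>\<^sup>2) \<le> \<bar>x / y - 1\<bar> * \<bar>1 - x * y\<bar>"
    using xy by (intro mult_left_mono) auto
  ultimately show ?thesis using \<rho> by (simp add: pos_le_divide_eq)
qed

section \<open>Phase, coefficients and the scaled equation\<close>

lemma jacobi_phase_Suc:
  assumes "\<bar>jacobi_beta a b n\<bar> \<ge> 1"
  shows "jacobi_phase a b (Suc n) = jacobi_phase a b n + arcosh \<bar>jacobi_beta a b n\<bar>"
proof -
  have "{m. m < Suc n \<and> \<bar>jacobi_beta a b m\<bar> \<ge> 1} = insert n {m. m < n \<and> \<bar>jacobi_beta a b m\<bar> \<ge> 1}"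
    using assms by (auto simp: less_Suc_eq)
  then show ?thesis by (simp add: jacobi_phase_def)
qed

text \<open>By the inequality of arithmetic and geometric means,
  \<open>jacobi_alpha a (n + 1)\<close> is dominated by the reciprocals of its two neighbouring
  coefficients. The shift avoids the conventional value at index -1.\<close>

lemma summable_jacobi_alpha:
  assumes pos: "\<And>n. a n > 0" and sum: "summable (\<lambda>n. inverse (a n))"
  shows "summable (jacobi_alpha a)"
proof -
  have "summable (\<lambda>n. jacobi_alpha a (Suc n))"
  proof (rule summable_comparison_test')
    show "summable (\<lambda>n. inverse (a n) + inverse (a (Suc n)))"
      using sum summable_ignore_initial_segment[OF sum, of 1] by (intro summable_add) auto
    fix n :: nat
    have "jacobi_alpha a (Suc n) = sqrt (inverse (a n) * inverse (a (Suc n))) / 2"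
    proof -
      have "sqrt (inverse (a n) * inverse (a (Suc n))) = inverse (sqrt (a n * a (Suc n)))"
        by (metis inverse_mult_distrib real_sqrt_inverse)
      moreover have "1 / (2 * s) = inverse s / 2" for s :: real
        by (simp add: inverse_eq_divide)
      ultimately show ?thesis by (simp only: jacobi_alpha_def coeff_pred_def nat.case)
    qed
    also have "\<dots> \<le> ((inverse (a n) + inverse (a (Suc n))) / 2) / 2"
      using pos[of n] pos[of "Suc n"]
      by (intro divide_right_mono arith_geo_mean_sqrt) auto
    also have "\<dots> \<le> inverse (a n) + inverse (a (Suc n))"
      using pos[of n] pos[of "Suc n"] by simp
    finally show "norm (jacobi_alpha a (Suc n)) \<le> inverse (a n) + inverse (a (Suc n))"
      using pos[of n] pos[of "Suc n"] by (simp add: jacobi_alpha_def coeff_pred_def)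
  qed
  then show ?thesis by (rule iffD1[OF summable_Suc_iff])
qed

text \<open>The Jacobi equation at \<open>n + 1\<close> after the Liouville--Green substitution, with
  \<open>r\<^sub>i = sqrt (a (n + i))\<close>, \<open>x = \<zeta> n\<close> and \<open>y = \<zeta> (n + 1)\<close>.\<close>

lemma jacobi_equation_scaled:
  fixes r0 r1 r2 W x y \<beta> z u0 u1 u2 :: complex
  assumes "r0 \<noteq> 0" "r1 \<noteq> 0" "r2 \<noteq> 0"
    and u0: "u0 = 2 * (\<beta> + z / (2 * (r0 * r1))) * x * u1 - r1\<^sup>2 / (r0 * r2) * x * y * u2"
  shows "r0\<^sup>2 * (W / r0 * u0) =
    (z + 2 * (r0 * r1) * \<beta>) * (W * x / r1 * u1) - r1\<^sup>2 * (W * x * y / r2 * u2)"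
proof -
  have "r0\<^sup>2 * (W / r0 * u0) = r0 * W * u0"
    using assms(1) by (simp add: power2_eq_square)
  moreover have "r0 * W * (2 * (\<beta> + z / (2 * (r0 * r1))) * x * u1)
      = (z + 2 * (r0 * r1) * \<beta>) * (W * x / r1 * u1)"
  proof -
    have "2 * (\<beta> + z / (2 * (r0 * r1))) = (z + 2 * (r0 * r1) * \<beta>) / (r0 * r1)"
      using assms(1,2) by (simp add: add_divide_distrib distrib_left)
    then show ?thesis using assms(1,2) by simp
  qed
  moreover have "r0 * W * (r1\<^sup>2 / (r0 * r2) * x * y * u2) = r1\<^sup>2 * (W * x * y / r2 * u2)"
    using assms(1,3) by simp
  ultimately show ?thesis unfolding u0 right_diff_distrib by simp
qed

text \<open>A second \<open>exp x\<close> absorbs the factor 1 + x. For x affine in |z| this leaves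
  a pure exponential whose rate is twice the slope.\<close>

lemma norm_le_exp_double:
  fixes v :: complex
  assumes "norm (v - 1) \<le> x * exp x" "x \<ge> 0"
  shows "norm v \<le> exp (2 * x)"
proof -
  have "norm v \<le> 1 + norm (v - 1)"
    using norm_triangle_ineq[of 1 "v - 1"] by simp
  also have "\<dots> \<le> exp x + x * exp x"
    using assms by (intro add_mono) auto
  also have "\<dots> = (1 + x) * exp x"
    by (simp add: distrib_right)
  also have "\<dots> \<le> exp x * exp x"
    by (intro mult_right_mono) auto
  also have "\<dots> = exp (2 * x)"
    by (simp add: mult_exp_exp)
  finally show ?thesis .
qed

lemma suminf_tail_le:
  fixes f :: "nat \<Rightarrow> real"
  assumes "summable f" "\<And>n. f n \<ge> 0"
  shows "(\<Sum>m. f (n + m)) \<le> suminf f"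
  using suminf_minus_initial_segment[OF assms(1), of n] sum_nonneg[of "{..<n}" f] assms(2)
  by (simp add: add.commute)

theorem theorem3p9:
  fixes a b :: "nat \<Rightarrow> real" and \<beta>inf :: real
  assumes "\<And>n. a n > 0"
    and "summable (\<lambda>n. inverse (a n))"
    and "jacobi_beta a b \<longlonglongrightarrow> \<beta>inf"
    and "\<bar>\<beta>inf\<bar> > 1"
    and "summable (\<lambda>n. \<bar>jacobi_k a n - 1\<bar>)"
    and "summable (\<lambda>n. \<bar>jacobi_beta a b (n + 1) - jacobi_beta a b n\<bar>)"
  shows "\<exists>f :: int \<Rightarrow> complex \<Rightarrow> complex.
      (\<forall>z. jacobi_solution a b z (\<lambda>n. f n z)) \<and>
      (\<forall>K. compact K \<longrightarrow>
        (\<exists>C::real. \<forall>\<^sub>F n in sequentially. \<forall>z\<in>K. \<exists>r::complex.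
           f (int n) z =
             of_real (1 / sqrt (a n) * sgn \<beta>inf ^ n * exp (- jacobi_phase a b n)) * (1 + r) \<and>
           norm r \<le> C * jacobi_remainder a b z n)) \<and>
      (\<forall>n::nat. f (int n) holomorphic_on UNIV \<and> minimal_exponential_type (f (int n)))"
proof -

  \<comment> \<open>Recursion for the normalised solution\<close>
  define \<beta> where "\<beta> = jacobi_beta a b"
  define k where "k = jacobi_k a"
  define \<alpha> where "\<alpha> = jacobi_alpha a"
  define s where "s = sgn \<beta>inf"
  define \<zeta> where "\<zeta> = (\<lambda>n. s * exp (- arcosh \<bar>\<beta> n\<bar>))"
  obtain \<rho> N where \<rho>: "0 \<le> \<rho>" "\<rho> < 1"
    and \<beta>1: "\<And>n. n \<ge> N \<Longrightarrow> \<bar>\<beta> n\<bar> \<ge> 1"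
    and \<zeta>_le: "\<And>n. n \<ge> N \<Longrightarrow> \<bar>\<zeta> n\<bar> \<le> \<rho>"
    and \<zeta>\<beta>: "\<And>n. n \<ge> N \<Longrightarrow> \<zeta> n + 1 / \<zeta> n = 2 * \<beta> n"
    using eventually_joukowski_ratio[OF assms(3,4)] unfolding \<beta>_def \<zeta>_def s_def by blast
  have \<zeta>0: "\<zeta> n \<noteq> 0" for n using assms(4) by (auto simp: \<zeta>_def s_def sgn_if)
  define \<kappa> where "\<kappa> = \<rho>\<^sup>2"
  have \<kappa>: "0 \<le> \<kappa>" "\<kappa> < 1" using \<rho> by (auto simp: \<kappa>_def abs_square_less_1)
  \<comment> \<open>The 2 comes from \<zeta> + 1/\<zeta> = 2\<beta> and from the factor 2\<alpha>,
    and 1/(1 - \<kappa>) from comparing consecutive roots. The other error terms have coefficients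
    at most \<kappa> < L.\<close>
  define L where "L = 2 / (1 - \<kappa>)"
  have L: "L \<ge> 2" using \<kappa> by (simp add: L_def field_simps)
  have \<alpha>0: "\<alpha> n \<ge> 0" for n
    using assms(1) by (auto simp: \<alpha>_def jacobi_alpha_def coeff_pred_def less_imp_le split: nat.split)

  \<comment> \<open>The substitution gives u(n) = 2(\<beta>(n+1) + z \<alpha>(n+1)) \<zeta>(n)
    u(n+1) - B(n) u(n+2), and A(n) is the coefficient of u(n+1) minus 1 + B(n). The equation for
    \<zeta>(n+1) exhibits A as small. The value 0 below N makes the bounds valid for all n.\<close>
  define A :: "nat \<Rightarrow> complex \<Rightarrow> complex" where
    "A = (\<lambda>n z. if n < N then 0 else
       of_real (\<zeta> n / \<zeta> (Suc n) - 1 + \<zeta> n * \<zeta> (Suc n) * (1 - k (Suc n)))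
         + z * of_real (2 * \<alpha> (Suc n) * \<zeta> n))"
  define B :: "nat \<Rightarrow> complex \<Rightarrow> complex" where
    "B = (\<lambda>n z. if n < N then 0 else of_real (\<zeta> n * \<zeta> (Suc n) * k (Suc n)))"
  \<comment> \<open>p(n) + q(n)|z| is L times the remainder summand of index n + 1, so the tail from
    n is exactly L times the remainder at n.\<close>
  define p where "p = (\<lambda>n. L * (\<bar>\<beta> (Suc n) - \<beta> n\<bar> + \<bar>k (Suc n) - 1\<bar>))"
  define q where "q = (\<lambda>n. L * \<alpha> (Suc n))"
  have p0: "p n \<ge> 0" and q0: "q n \<ge> 0" for n
    using L \<alpha>0 by (auto simp: p_def q_def)
  have sp: "summable p"
    unfolding p_def \<beta>_def k_def using assms(6) summable_ignore_initial_segment[OF assms(5), of 1]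
    by (intro summable_mult summable_add) auto
  have sq: "summable q"
    unfolding q_def \<alpha>_def
    using summable_ignore_initial_segment[OF summable_jacobi_alpha[OF assms(1,2)], of 1]
    by (intro summable_mult) auto

  have xy_le: "\<bar>\<zeta> n * \<zeta> (Suc n)\<bar> \<le> \<kappa>" if "n \<ge> N" for n
    unfolding abs_mult \<kappa>_def power2_eq_square using \<zeta>_le that \<rho> by (intro mult_mono) auto
  have A_le: "norm (A n z) \<le> p n + q n * norm z" for n z
  proof (cases "n < N")
    case True
    then show ?thesis using p0 q0 by (simp add: A_def)
  next
    case False
    then have n: "n \<ge> N" "Suc n \<ge> N" by auto
    define x1 where "x1 = \<zeta> n / \<zeta> (Suc n) - 1"
    define x2 where "x2 = \<zeta> n * \<zeta> (Suc n) * (1 - k (Suc n))"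
    define x3 where "x3 = 2 * \<alpha> (Suc n) * \<zeta> n"
    have "\<bar>x1\<bar> \<le> \<bar>2 * \<beta> (Suc n) - 2 * \<beta> n\<bar> / (1 - \<kappa>)"
      using joukowski_ratio_diff[OF \<zeta>0[of n] \<zeta>0[of "Suc n"] \<zeta>_le[OF n(1)] \<zeta>_le[OF n(2)] \<rho>(2)]
      unfolding \<zeta>\<beta>[OF n(1)] \<zeta>\<beta>[OF n(2)] x1_def \<kappa>_def .
    also have "\<dots> = L * \<bar>\<beta> (Suc n) - \<beta> n\<bar>"
      unfolding L_def right_diff_distrib[symmetric] abs_mult by simp
    finally have 1: "\<bar>x1\<bar> \<le> L * \<bar>\<beta> (Suc n) - \<beta> n\<bar>" .
    have "\<bar>x2\<bar> \<le> L * \<bar>1 - k (Suc n)\<bar>"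
      unfolding x2_def abs_mult[of _ "1 - k (Suc n)"] using xy_le[OF n(1)] \<kappa> L
      by (intro mult_right_mono) auto
    then have 2: "\<bar>x2\<bar> \<le> L * \<bar>k (Suc n) - 1\<bar>" by (simp only: abs_minus_commute)
    have "\<bar>x3\<bar> = (2 * \<bar>\<zeta> n\<bar>) * \<alpha> (Suc n)"
      unfolding x3_def abs_mult using \<alpha>0[of "Suc n"] by simp
    also have "\<dots> \<le> L * \<alpha> (Suc n)"
      using \<zeta>_le[OF n(1)] \<rho> L \<alpha>0[of "Suc n"] by (intro mult_right_mono) auto
    finally have 3: "\<bar>x3\<bar> * norm z \<le> q n * norm z"
      unfolding q_def by (intro mult_right_mono) auto
    have "A n z = of_real (x1 + x2) + z * of_real x3"
      using False by (simp add: A_def x1_def x2_def x3_def)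
    then have "norm (A n z) \<le> \<bar>x1 + x2\<bar> + norm z * \<bar>x3\<bar>"
      using norm_triangle_ineq[of "of_real (x1 + x2)" "z * of_real x3"]
      by (simp only: norm_mult norm_of_real)
    also have "\<dots> \<le> \<bar>x1\<bar> + \<bar>x2\<bar> + \<bar>x3\<bar> * norm z"
      using abs_triangle_ineq[of x1 x2] by (simp add: mult.commute)
    also have "\<dots> \<le> p n + q n * norm z"
      using 1 2 3 unfolding p_def distrib_left by linarith
    finally show ?thesis .
  qed
  have B_le: "norm (B n z) \<le> \<kappa> + (p n + q n * norm z)" for n z
  proof (cases "n < N")
    case True
    then show ?thesis using p0[of n] q0[of n] \<kappa> by (simp add: B_def)
  next
    case False
    have "norm (B n z) = \<bar>\<zeta> n * \<zeta> (Suc n)\<bar> * \<bar>k (Suc n)\<bar>"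
      using False unfolding B_def by (simp only: if_False norm_of_real abs_mult)
    also have "\<dots> \<le> \<kappa> * (1 + \<bar>k (Suc n) - 1\<bar>)"
      using xy_le[of n] False \<kappa> by (intro mult_mono) auto
    also have "\<dots> \<le> \<kappa> + L * \<bar>k (Suc n) - 1\<bar>"
      unfolding distrib_left using \<kappa> L mult_right_mono[of \<kappa> L "\<bar>k (Suc n) - 1\<bar>"] by simp
    also have "\<dots> \<le> \<kappa> + (p n + q n * norm z)"
      using q0[of n] L by (simp add: p_def distrib_left)
    finally show ?thesis .
  qed
  have hol: "A n holomorphic_on UNIV" "B n holomorphic_on UNIV" for n
    unfolding A_def B_def by (cases "n < N"; simp; intro holomorphic_intros)+
  obtain C u where C: "C \<ge> 0"
    and u_hol: "\<And>n. u n holomorphic_on UNIV"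
    and u_rec: "\<And>n z. u n z - u (Suc n) z =
       A n z * u (Suc n) z + B n z * (u (Suc n) z - u (Suc (Suc n)) z)"
    and u_est: "\<And>n z. norm (u n z - 1) \<le> C * (\<Sum>m. p (n + m) + q (n + m) * norm z)
              * exp (C * (\<Sum>m. p (n + m) + q (n + m) * norm z))"
    using backward_recursion_solution[OF hol \<kappa> p0 q0 sp sq A_le B_le] by blast

  \<comment> \<open>Tails of the bounds\<close>
  define P where "P = (\<lambda>n. \<Sum>m. p (n + m))"
  define Q where "Q = (\<lambda>n. \<Sum>m. q (n + m))"
  have sp': "summable (\<lambda>m. p (n + m))" and sq': "summable (\<lambda>m. q (n + m))" for n
    using sp sq by (simp_all add: add.commute[of n])
  have P0: "P n \<ge> 0" "P n \<le> suminf p" and Q0: "Q n \<ge> 0" "Q n \<le> suminf q" for n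
    unfolding P_def Q_def using sp sq sp' sq' p0 q0
    by (auto intro!: suminf_nonneg suminf_tail_le)
  have PQ: "(\<Sum>m. p (n + m) + q (n + m) * norm z) = P n + Q n * norm z" for n and z :: complex
    unfolding P_def Q_def
    by (subst suminf_mult2[OF sq']) (intro suminf_add[symmetric] sp' summable_mult2 sq')
  have remainder: "P n + Q n * norm z = L * jacobi_remainder a b z n" for n z
  proof -
    have r: "p (n + m) + q (n + m) * norm z = L * remainder_term a b z (n + 1 + m)" for m
      by (simp add: p_def q_def remainder_term_def \<beta>_def k_def \<alpha>_def algebra_simps abs_minus_commute)
    have "summable (\<lambda>m. L * remainder_term a b z (n + 1 + m))"
      unfolding r[symmetric] by (intro summable_add sp' summable_mult2 sq')
    then have "summable (\<lambda>m. remainder_term a b z (n + 1 + m))"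
      using L by (simp add: summable_cmult_iff)
    then show ?thesis
      unfolding PQ[symmetric] r jacobi_remainder_def by (rule suminf_mult)
  qed

  \<comment> \<open>Return to the Jacobi equation\<close>
  define W where "W = (\<lambda>n. s ^ n * exp (- jacobi_phase a b n))"
  \<comment> \<open>From N on every index contributes to the phase, so each step multiplies by the
    characteristic root.\<close>
  have W_Suc: "W (Suc n) = W n * \<zeta> n" if "n \<ge> N" for n
    using jacobi_phase_Suc[of a b n] \<beta>1[OF that]
    by (simp add: W_def \<zeta>_def \<beta>_def mult_exp_exp)
  define g :: "nat \<Rightarrow> complex \<Rightarrow> complex" where
    "g = (\<lambda>n z. of_real (W n / sqrt (a n)) * u n z)"
  \<comment> \<open>This is the Jacobi equation at index n + 1, solved for the lowest term.\<close>
  have g_rec: "of_real (a n) * g n z =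
      (z - of_real (b (Suc n))) * g (Suc n) z - of_real (a (Suc n)) * g (Suc (Suc n)) z"
    if n: "n \<ge> N" for n z
  proof -
    define r where "r = (\<lambda>n. complex_of_real (sqrt (a n)))"
    have r0: "r n \<noteq> 0" for n using assms(1)[of n] by (simp add: r_def)
    have r2: "(r n)\<^sup>2 = of_real (a n)" for n
      using assms(1)[of n] by (simp add: r_def flip: of_real_power)
    have \<alpha>': "complex_of_real (\<alpha> (Suc n)) = 1 / (2 * (r n * r (Suc n)))"
      by (simp add: \<alpha>_def jacobi_alpha_def coeff_pred_def r_def real_sqrt_mult)
    have k': "complex_of_real (k (Suc n)) = (r (Suc n))\<^sup>2 / (r n * r (Suc (Suc n)))"
      unfolding r2 by (simp add: k_def jacobi_k_def coeff_pred_def r_def real_sqrt_mult)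
    have "b (Suc n) = - 2 * (sqrt (a n) * sqrt (a (Suc n))) * \<beta> (Suc n)"
      using assms(1)[of n] assms(1)[of "Suc n"]
      by (simp add: \<beta>_def jacobi_beta_def coeff_pred_def real_sqrt_mult)
    then have b': "complex_of_real (b (Suc n)) = - 2 * (r n * r (Suc n)) * of_real (\<beta> (Suc n))"
      by (simp add: r_def)
    have AB: "1 + A n z + B n z = 2 * (of_real (\<beta> (Suc n)) + z * of_real (\<alpha> (Suc n))) * of_real (\<zeta> n)"
    proof -
      have "1 + (\<zeta> n / \<zeta> (Suc n) - 1 + \<zeta> n * \<zeta> (Suc n) * (1 - k (Suc n)))
          + \<zeta> n * \<zeta> (Suc n) * k (Suc n) = (\<zeta> (Suc n) + 1 / \<zeta> (Suc n)) * \<zeta> n"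
        by (simp add: algebra_simps)
      also have "\<dots> = 2 * \<beta> (Suc n) * \<zeta> n"
        using \<zeta>\<beta>[of "Suc n"] n by simp
      finally have "complex_of_real (1 + (\<zeta> n / \<zeta> (Suc n) - 1 + \<zeta> n * \<zeta> (Suc n) * (1 - k (Suc n)))
          + \<zeta> n * \<zeta> (Suc n) * k (Suc n)) = of_real (2 * \<beta> (Suc n) * \<zeta> n)"
        by (simp only:)
      then show ?thesis using n by (simp add: A_def B_def algebra_simps)
    qed
    have "u n z = (1 + A n z + B n z) * u (Suc n) z - B n z * u (Suc (Suc n)) z"
      using u_rec[of n z] by (simp add: algebra_simps)
    then have "u n z = 2 * (of_real (\<beta> (Suc n)) + z / (2 * (r n * r (Suc n)))) * of_real (\<zeta> n) * u (Suc n) z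
        - (r (Suc n))\<^sup>2 / (r n * r (Suc (Suc n))) * of_real (\<zeta> n) * of_real (\<zeta> (Suc n)) * u (Suc (Suc n)) z"
      unfolding AB using n by (simp add: B_def \<alpha>' k')
    from jacobi_equation_scaled[OF r0 r0 r0 this, of "of_real (W n)"]
    show ?thesis
      using W_Suc[of n] W_Suc[of "Suc n"] n
      by (simp add: b' g_def r2 flip: r_def) (simp add: r_def)
  qed

  \<comment> \<open>\<open>h i\<close> is the solution at index \<open>i - 1\<close>, so that the equation at \<open>i = 0\<close> is covered.\<close>
  define step :: "nat \<Rightarrow> (complex \<Rightarrow> complex) \<Rightarrow> (complex \<Rightarrow> complex) \<Rightarrow> complex \<Rightarrow> complex" where
    "step = (\<lambda>i F G z. ((z - of_real (b i)) * F z - of_real (a i) * G z) / of_real (coeff_pred a i))"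
  \<comment> \<open>Here i is positive, so \<open>i - 1\<close> does not truncate.\<close>
  have "g (i - 1) = step i (g (Suc i - 1)) (g (Suc (Suc i) - 1))" if "i \<ge> Suc N" for i
  proof -
    from that obtain n where n: "i = Suc n" "n \<ge> N" by (cases i) auto
    show ?thesis
    proof
      fix z
      show "g (i - 1) z = step i (g (Suc i - 1)) (g (Suc (Suc i) - 1)) z"
        using g_rec[OF n(2), of z] assms(1)[of n]
        by (simp add: n(1) step_def coeff_pred_def eq_divide_eq mult.commute)
    qed
  qed
  from backward_extension[where g = "\<lambda>i. g (i - 1)" and step = step and N = "Suc N", OF this]
  obtain h where
    h_g: "\<And>i. i \<ge> Suc N \<Longrightarrow> h i = g (i - 1)" and
    h_rec: "\<And>i. h i = step i (h (Suc i)) (h (Suc (Suc i)))"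
    by blast

  \<comment> \<open>Holomorphy and exponential type\<close>
  have g_hol: "g n holomorphic_on UNIV" for n
    unfolding g_def by (intro holomorphic_intros u_hol)
  have h_hol: "h i holomorphic_on UNIV" for i
  proof (rule backward_induct[of "Suc N"])
    show "h i holomorphic_on UNIV" if "i \<ge> Suc N" for i using h_g[OF that] g_hol by simp
    show "h i holomorphic_on UNIV"
      if "h (Suc i) holomorphic_on UNIV" "h (Suc (Suc i)) holomorphic_on UNIV" for i
      unfolding h_rec[of i] step_def divide_inverse using that by (intro holomorphic_intros)
  qed

  have h_exp: "\<exists>D. \<forall>z. norm (h i z) \<le> D * exp (\<delta> * norm z)" if \<delta>: "\<delta> > 0" for \<delta> i
  proof -
    \<comment> \<open>Once Q(n) is below this value, 2 C Q(n) \<le> \<delta>/2; the added 1 covers C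
      = 0.\<close>
    have "\<delta> / 2 / (2 * C + 1) > 0" using \<delta> C by simp
    from suminf_exist_split[OF this sq] obtain M
      where M: "\<And>n. n \<ge> M \<Longrightarrow> norm (\<Sum>i. q (i + n)) < \<delta> / 2 / (2 * C + 1)" by blast
    have u_exp: "norm (u n z) \<le> exp (2 * C * P n) * exp (\<delta> / 2 * norm z)" if "n \<ge> M" for n z
    proof -
      have "Q n < \<delta> / 2 / (2 * C + 1)"
        using M[OF that] Q0(1)[of n] by (simp add: Q_def add.commute[of n])
      then have "Q n * (2 * C + 1) < \<delta> / 2"
        using C by (subst (asm) pos_less_divide_eq) auto
      then have Qn: "2 * C * Q n \<le> \<delta> / 2"
        using Q0(1)[of n] by (simp add: distrib_left mult.commute mult.left_commute)
      have "norm (u n z) \<le> exp (2 * (C * (P n + Q n * norm z)))"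
        using u_est[of n z] C P0 Q0 unfolding PQ by (intro norm_le_exp_double) auto
      also have "\<dots> = exp (2 * C * P n) * exp (2 * C * Q n * norm z)"
      proof -
        have "2 * (C * (P n + Q n * norm z)) = 2 * C * P n + 2 * C * Q n * norm z"
          by (simp add: algebra_simps)
        then show ?thesis by (simp only: exp_add)
      qed
      also have "\<dots> \<le> exp (2 * C * P n) * exp (\<delta> / 2 * norm z)"
        using mult_right_mono[OF Qn, of "norm z"] by simp
      finally show ?thesis .
    qed
    \<comment> \<open>Half of \<delta> is spent on u at large indices. All exponents above
      \<delta>/2 are carried down together, and \<delta> itself is chosen only at the end.\<close>
    have "\<forall>\<delta>'>\<delta> / 2. \<exists>D. \<forall>z. norm (h i z) \<le> D * exp (\<delta>' * norm z)"
    proof (rule backward_induct[of "Suc (max M N)"])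
      fix i :: nat assume i: "i \<ge> Suc (max M N)"
      show "\<forall>\<delta>'>\<delta> / 2. \<exists>D. \<forall>z. norm (h i z) \<le> D * exp (\<delta>' * norm z)"
      proof (intro allI impI exI)
        fix \<delta>' z assume \<delta>': "\<delta>' > \<delta> / 2"
        define c where "c = \<bar>W (i - 1) / sqrt (a (i - 1))\<bar>"
        have "norm (h i z) = c * norm (u (i - 1) z)"
          using h_g[of i] i by (simp add: g_def norm_mult c_def del: of_real_divide)
        also have "\<dots> \<le> c * (exp (2 * C * P (i - 1)) * exp (\<delta> / 2 * norm z))"
          using i by (intro mult_left_mono u_exp) (auto simp: c_def)
        also have "\<dots> \<le> c * (exp (2 * C * P (i - 1)) * exp (\<delta>' * norm z))"
        proof -
          have "\<delta> / 2 * norm z \<le> \<delta>' * norm z"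
            using \<delta>' by (intro mult_right_mono) auto
          then show ?thesis by (intro mult_left_mono) (auto simp: c_def)
        qed
        finally show "norm (h i z) \<le> (\<bar>W (i - 1) / sqrt (a (i - 1))\<bar> * exp (2 * C * P (i - 1))) * exp (\<delta>' * norm z)"
          by (simp only: c_def mult.assoc)
      qed
    next
      fix i
      assume F: "\<forall>\<delta>'>\<delta> / 2. \<exists>D. \<forall>z. norm (h (Suc i) z) \<le> D * exp (\<delta>' * norm z)"
        and G: "\<forall>\<delta>'>\<delta> / 2. \<exists>D. \<forall>z. norm (h (Suc (Suc i)) z) \<le> D * exp (\<delta>' * norm z)"
      show "\<forall>\<delta>'>\<delta> / 2. \<exists>D. \<forall>z. norm (h i z) \<le> D * exp (\<delta>' * norm z)"
        unfolding h_rec[of i] step_def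
        using exp_bound_recursion[OF F[rule_format] G[rule_format]] by blast
    qed
    then show ?thesis using \<delta> by auto
  qed

  \<comment> \<open>Verification of the claims\<close>
  \<comment> \<open>The shift puts \<open>h 0\<close> at index -1; \<open>nat\<close> also assigns
    it to all lower indices, where the equation imposes nothing.\<close>
  define f where "f = (\<lambda>j::int. h (nat (j + 1)))"
  have f_int: "f (int n) = h (Suc n)" for n
    by (simp add: f_def nat_add_distrib)
  show ?thesis
  proof (intro exI[of _ f] conjI allI impI)
    fix z
    show "jacobi_solution a b z (\<lambda>n. f n z)"
      unfolding jacobi_solution_def
    proof
      fix n
      have "f (int n - 1) = h n" "f (int n + 1) = h (Suc (Suc n))"
        by (simp_all add: f_def nat_add_distrib)
      moreover have "complex_of_real (coeff_pred a n) \<noteq> 0"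
        using assms(1) by (auto simp: coeff_pred_def less_imp_neq[symmetric] split: nat.split)
      then have "of_real (coeff_pred a n) * h n z =
          (z - of_real (b n)) * h (Suc n) z - of_real (a n) * h (Suc (Suc n)) z"
        by (subst h_rec[of n]) (simp add: step_def)
      ultimately show "of_real (coeff_pred a n) * f (int n - 1) z + of_real (b n) * f (int n) z
               + of_real (a n) * f (int n + 1) z = z * f (int n) z"
        by (simp add: f_int algebra_simps)
    qed
  next
    fix K :: "complex set" assume "compact K"
    then obtain R where R: "\<And>z. z \<in> K \<Longrightarrow> norm z \<le> R"
      using compact_imp_bounded bounded_iff by metis
    \<comment> \<open>On K this bounds the exponent for every n, so the exponential factor in the
      estimate of u - 1 becomes the constant \<open>exp M\<close>.\<close>
    define M where "M = C * (suminf p + suminf q * R)"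
    show "\<exists>C::real. \<forall>\<^sub>F n in sequentially. \<forall>z\<in>K. \<exists>r::complex.
           f (int n) z =
             of_real (1 / sqrt (a n) * sgn \<beta>inf ^ n * exp (- jacobi_phase a b n)) * (1 + r) \<and>
           norm r \<le> C * jacobi_remainder a b z n"
    proof (intro exI eventually_mono[OF eventually_ge_at_top[of N]] ballI conjI)
      fix n z assume n: "n \<ge> N" and z: "z \<in> K"
      show "f (int n) z =
             of_real (1 / sqrt (a n) * sgn \<beta>inf ^ n * exp (- jacobi_phase a b n)) * (1 + (u n z - 1))"
        using h_g[of "Suc n"] n by (simp add: f_int g_def W_def s_def)
      have "Q n * norm z \<le> suminf q * R"
        using Q0[of n] R[OF z] by (intro mult_mono) (auto intro: order_trans)
      then have "C * (P n + Q n * norm z) \<le> M"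
        unfolding M_def using C P0(2)[of n] by (intro mult_left_mono add_mono) auto
      then have "C * (P n + Q n * norm z) * exp (C * (P n + Q n * norm z))
          \<le> C * (P n + Q n * norm z) * exp M"
        using C P0 Q0 by (intro mult_left_mono) auto
      also have "\<dots> = C * L * exp M * jacobi_remainder a b z n"
        unfolding remainder by simp
      finally show "norm (u n z - 1) \<le> C * L * exp M * jacobi_remainder a b z n"
        using u_est[of n z] unfolding PQ by linarith
    qed
  next
    fix n :: nat
    show "f (int n) holomorphic_on UNIV" unfolding f_int by (rule h_hol)
    show "minimal_exponential_type (f (int n))"
      unfolding minimal_exponential_type_def f_int using h_exp by blast
  qed
qed

end
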